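(* Let $\alpha$ be an ordinal. Every substitution algebra of dimension $\alpha$ in which elements are strongly distinguished is representable, i.e. isomorphic to a function substitution algebra of dimension $\alpha$.
   Context: For a nonempty set $U$, $F_\alpha(U)$ is the set of all functions $U^\alpha\to U$. For $s\in U^\alpha$, $\kappa<\alpha$, $x\in U$, $s\langle\kappa,x\rangle$ agrees with $s$ except that its $\kappa$-th entry is $x$. On $F_\alpha(U)$ set $(f*_\kappa g)(s)=g(s\langle\kappa,f(s)\rangle)$ and $V_\kappa(s)=s_\kappa$. A function substitution algebra of dimension $\alpha$ ($FSA_\alpha$) with base $U$ is $\langle A,*_\kappa,V_\kappa\rangle_{\kappa<\alpha}$ with $A\subseteq F_\alpha(U)$ closed under every $*_\kappa$ and containing every $V_\kappa$. A substitution algebra of dimension $\alpha$ ($SA_\alpha$) is an algebra $\langle A,*_\kappa,v_\kappa\rangle_{\kappa<\alpha}$ satisfying, for all $\kappa,\lambda<\alpha$: (1) $x*_\kappa v_\kappa=x$; (2) $x*_\kappa v_\lambda=v_\lambda$ for $\kappa\neq\lambda$; (3) $v_\kappa*_\kappa x=x$; (4) if $w*_\lambda x=x$ for all $w$, then $x*_\lambda(v_\lambda*_\kappa z)=x*_\lambda(x*_\kappa z)$; (5) $(x*_\kappa y)*_\kappa z=x*_\kappa(y*_\kappa z)$; (6) if $w*_\lambda x=x$ for all $w$, then $x*_\kappa(y*_\lambda z)=(x*_\kappa y)*_\lambda(x*_\kappa z)$ for $\kappa\neq\lambda$. For $x\in A$, $\Delta x=\{\kappa<\alpha: a*_\kappa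 x\neq x\text{ for some }a\in A\}$, and $Z=\{x\in A:\Delta x=\emptyset\}$. For $s\in A^\alpha$, $a\in A$, finite $\Sigma=\{\kappa_0<\dots<\kappa_{n-1}\}\subseteq\alpha$: $s*_{(\Sigma)}a=s_{\kappa_{n-1}}*_{\kappa_{n-1}}(\cdots(s_{\kappa_0}*_{\kappa_0}a)\cdots)$, with $s*_{(\emptyset)}a=a$. Elements are strongly distinguished in $\mathfrak{A}$ if for all $a,b\in A$: whenever for every $s\in Z^\alpha$ there is a finite $\Sigma\subseteq\alpha$ with $s*_{(\Sigma)}a=s*_{(\Sigma)}b$, then $a=b$. *)

theory Defs
  imports Main "HOL-Library.FuncSet"
begin

text \<open>
  An ordinal \<open>\<alpha>\<close> is given as an element of an arbitrary well-ordered type \<open>'i\<close>, and stands for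
  the order type of its initial segment \<open>{..<\<alpha>}\<close>. Every ordinal arises like this
  (as the greatest element of a well-order of type \<open>\<alpha> + 1\<close>), including \<open>0\<close>.
  The fields \<open>subst\<close> and \<open>var\<close> of an algebra are relevant only at indices \<open>\<kappa> < \<alpha>\<close> and on
  elements of the universe.
\<close>

record ('i, 'a) subst_alg =
  univ :: "'a set"
  subst :: "'i \<Rightarrow> 'a \<Rightarrow> 'a \<Rightarrow> 'a"
  var :: "'i \<Rightarrow> 'a"


subsection \<open>Function substitution algebras\<close>

definition tuples :: "'i::wellorder \<Rightarrow> 'u set \<Rightarrow> ('i \<Rightarrow> 'u) set" where
  "tuples \<alpha> U = {..<\<alpha>} \<rightarrow>\<^sub>E U"

definition funs :: "'i::wellorder \<Rightarrow> 'u set \<Rightarrow> (('i \<Rightarrow> 'u) \<Rightarrow> 'u) set" where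
  "funs \<alpha> U = tuples \<alpha> U \<rightarrow>\<^sub>E U"

definition fun_subst ::
    "'i::wellorder \<Rightarrow> 'u set \<Rightarrow> 'i \<Rightarrow> (('i \<Rightarrow> 'u) \<Rightarrow> 'u) \<Rightarrow> (('i \<Rightarrow> 'u) \<Rightarrow> 'u) \<Rightarrow> (('i \<Rightarrow> 'u) \<Rightarrow> 'u)" where
  "fun_subst \<alpha> U \<kappa> f g = (\<lambda>s\<in>tuples \<alpha> U. g (s(\<kappa> := f s)))"

definition fun_var :: "'i::wellorder \<Rightarrow> 'u set \<Rightarrow> 'i \<Rightarrow> (('i \<Rightarrow> 'u) \<Rightarrow> 'u)" where
  "fun_var \<alpha> U \<kappa> = (\<lambda>s\<in>tuples \<alpha> U. s \<kappa>)"

definition function_substitution_algebra ::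
    "'i::wellorder \<Rightarrow> 'u set \<Rightarrow> ('i, ('i \<Rightarrow> 'u) \<Rightarrow> 'u) subst_alg \<Rightarrow> bool" where
  "function_substitution_algebra \<alpha> U \<BB> \<longleftrightarrow>
     U \<noteq> {} \<and>
     univ \<BB> \<subseteq> funs \<alpha> U \<and>
     (\<forall>\<kappa><\<alpha>. \<forall>f\<in>univ \<BB>. \<forall>g\<in>univ \<BB>.
        subst \<BB> \<kappa> f g = fun_subst \<alpha> U \<kappa> f g \<and> fun_subst \<alpha> U \<kappa> f g \<in> univ \<BB>) \<and>
     (\<forall>\<kappa><\<alpha>. var \<BB> \<kappa> = fun_var \<alpha> U \<kappa> \<and> fun_var \<alpha> U \<kappa> \<in> univ \<BB>)"


subsection \<open>Substitution algebras\<close>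

definition substitution_algebra :: "'i::wellorder \<Rightarrow> ('i, 'a) subst_alg \<Rightarrow> bool" where
  "substitution_algebra \<alpha> \<AA> \<longleftrightarrow>
     (let A = univ \<AA>; sb = subst \<AA>; v = var \<AA> in
       (\<forall>\<kappa><\<alpha>. \<forall>x\<in>A. \<forall>y\<in>A. sb \<kappa> x y \<in> A) \<and>
       (\<forall>\<kappa><\<alpha>. v \<kappa> \<in> A) \<and>
       (\<forall>\<kappa><\<alpha>. \<forall>x\<in>A. sb \<kappa> x (v \<kappa>) = x) \<and>
       (\<forall>\<kappa><\<alpha>. \<forall>\<mu><\<alpha>. \<forall>x\<in>A. \<kappa> \<noteq> \<mu> \<longrightarrow> sb \<kappa> x (v \<mu>) = v \<mu>) \<and>
       (\<forall>\<kappa><\<alpha>. \<forall>x\<in>A. sb \<kappa> (v \<kappa>) x = x) \<and>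
       (\<forall>\<kappa><\<alpha>. \<forall>\<mu><\<alpha>. \<forall>x\<in>A. \<forall>z\<in>A. (\<forall>w\<in>A. sb \<mu> w x = x) \<longrightarrow>
          sb \<mu> x (sb \<kappa> (v \<mu>) z) = sb \<mu> x (sb \<kappa> x z)) \<and>
       (\<forall>\<kappa><\<alpha>. \<forall>x\<in>A. \<forall>y\<in>A. \<forall>z\<in>A. sb \<kappa> (sb \<kappa> x y) z = sb \<kappa> x (sb \<kappa> y z)) \<and>
       (\<forall>\<kappa><\<alpha>. \<forall>\<mu><\<alpha>. \<forall>x\<in>A. \<forall>y\<in>A. \<forall>z\<in>A. \<kappa> \<noteq> \<mu> \<longrightarrow> (\<forall>w\<in>A. sb \<mu> w x = x) \<longrightarrow>
          sb \<kappa> x (sb \<mu> y z) = sb \<mu> (sb \<kappa> x y) (sb \<kappa> x z)))"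

definition dim_set :: "'i::wellorder \<Rightarrow> ('i, 'a) subst_alg \<Rightarrow> 'a \<Rightarrow> 'i set" where
  "dim_set \<alpha> \<AA> x = {\<kappa>. \<kappa> < \<alpha> \<and> (\<exists>a\<in>univ \<AA>. subst \<AA> \<kappa> a x \<noteq> x)}"

definition zero_dim :: "'i::wellorder \<Rightarrow> ('i, 'a) subst_alg \<Rightarrow> 'a set" where
  "zero_dim \<alpha> \<AA> = {x \<in> univ \<AA>. dim_set \<alpha> \<AA> x = {}}"

text \<open>\<open>fold\<close> processes the least index first, so that substitution is the innermost one.\<close>

definition subst_seq :: "('i::wellorder, 'a) subst_alg \<Rightarrow> ('i \<Rightarrow> 'a) \<Rightarrow> 'i set \<Rightarrow> 'a \<Rightarrow> 'a" where
  "subst_seq \<AA> s \<Sigma> a = fold (\<lambda>\<kappa> b. subst \<AA> \<kappa> (s \<kappa>) b) (sorted_list_of_set \<Sigma>) a"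

definition strongly_distinguished :: "'i::wellorder \<Rightarrow> ('i, 'a) subst_alg \<Rightarrow> bool" where
  "strongly_distinguished \<alpha> \<AA> \<longleftrightarrow>
     (\<forall>a\<in>univ \<AA>. \<forall>b\<in>univ \<AA>.
        (\<forall>s\<in>tuples \<alpha> (zero_dim \<alpha> \<AA>).
           \<exists>\<Sigma>. finite \<Sigma> \<and> \<Sigma> \<subseteq> {..<\<alpha>} \<and> subst_seq \<AA> s \<Sigma> a = subst_seq \<AA> s \<Sigma> b) \<longrightarrow>
        a = b)"


subsection \<open>Representability\<close>

definition subst_alg_iso ::
    "'i::wellorder \<Rightarrow> ('i, 'a) subst_alg \<Rightarrow> ('i, 'b) subst_alg \<Rightarrow> ('a \<Rightarrow> 'b) \<Rightarrow> bool" where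
  "subst_alg_iso \<alpha> \<AA> \<BB> h \<longleftrightarrow>
     bij_betw h (univ \<AA>) (univ \<BB>) \<and>
     (\<forall>\<kappa><\<alpha>. \<forall>x\<in>univ \<AA>. \<forall>y\<in>univ \<AA>. h (subst \<AA> \<kappa> x y) = subst \<BB> \<kappa> (h x) (h y)) \<and>
     (\<forall>\<kappa><\<alpha>. h (var \<AA> \<kappa>) = var \<BB> \<kappa>)"

text \<open>
  HOL cannot quantify existentially over types, so the type \<open>'u\<close> from which the base \<open>U\<close> is
  taken is a parameter. Representability over any particular type implies representability in
  the usual sense.
\<close>

definition representable :: "'u itself \<Rightarrow> 'i::wellorder \<Rightarrow> ('i, 'a) subst_alg \<Rightarrow> bool" where
  "representable (_ :: 'u itself) \<alpha> \<AA> \<longleftrightarrow>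
     (\<exists>(U :: 'u set) \<BB> h. function_substitution_algebra \<alpha> U \<BB> \<and> subst_alg_iso \<alpha> \<AA> \<BB> h)"

end

theory Submission
  imports Defs Complex_Main
begin

text \<open>
  The base consists of nets \<open>f\<close> of elements, indexed by the finite sets \<open>\<Sigma>\<close> of coordinates, such
  that \<open>f \<Sigma>\<close> does not depend on the coordinates in \<open>\<Sigma>\<close>. An element \<open>a\<close> acts on a sequence \<open>s\<close> of
  nets by sending it to the net that substitutes \<open>s\<^sub>\<kappa> \<Sigma>\<close> for each \<open>\<kappa> \<in> \<Sigma>\<close> in \<open>a\<close>. As these
  substitutions commute, the homomorphism condition at \<open>\<kappa>\<close> holds at every \<open>\<Sigma>\<close> containing \<open>\<kappa>\<close>, thus
  up to eventual equality of nets. Eventual equality is not a congruence when infinitely many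
  entries of \<open>s\<close> change, so instead of a quotient the base is a transversal; the homomorphism
  condition survives because it changes a single entry. The transversal contains all constant nets
  with zero-dimensional value, and on these, strong distinguishedness is injectivity.
\<close>

section \<open>Axioms, commutation of substitutions and dimension sets\<close>

lemma substitution_algebraD:
  assumes "substitution_algebra \<alpha> \<AA>"
  shows "\<forall>\<kappa><\<alpha>. \<forall>x\<in>univ \<AA>. \<forall>y\<in>univ \<AA>. subst \<AA> \<kappa> x y \<in> univ \<AA>"
    and "\<forall>\<kappa><\<alpha>. var \<AA> \<kappa> \<in> univ \<AA>"
    and "\<forall>\<kappa><\<alpha>. \<forall>x\<in>univ \<AA>. subst \<AA> \<kappa> x (var \<AA> \<kappa>) = x"
    and "\<forall>\<kappa><\<alpha>. \<forall>\<mu><\<alpha>. \<forall>x\<in>univ \<AA>. \<kappa> \<noteq> \<mu> \<longrightarrow> subst \<AA> \<kappa> x (var \<AA> \<mu>) = var \<AA> \<mu>"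
    and "\<forall>\<kappa><\<alpha>. \<forall>x\<in>univ \<AA>. \<forall>y\<in>univ \<AA>. \<forall>z\<in>univ \<AA>.
      subst \<AA> \<kappa> (subst \<AA> \<kappa> x y) z = subst \<AA> \<kappa> x (subst \<AA> \<kappa> y z)"
    and "\<forall>\<kappa><\<alpha>. \<forall>\<mu><\<alpha>. \<forall>x\<in>univ \<AA>. \<forall>y\<in>univ \<AA>. \<forall>z\<in>univ \<AA>. \<kappa> \<noteq> \<mu> \<longrightarrow>
      (\<forall>w\<in>univ \<AA>. subst \<AA> \<mu> w x = x) \<longrightarrow>
      subst \<AA> \<kappa> x (subst \<AA> \<mu> y z) = subst \<AA> \<mu> (subst \<AA> \<kappa> x y) (subst \<AA> \<kappa> x z)"
  using assms unfolding substitution_algebra_def Let_def by - (elim conjE, assumption)+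

text \<open>A zero-dimensional element is used both as a test value in computing dimension sets and,
  as a constant net, to show that the base is nonempty.\<close>

locale substitution_algebra_with_zero =
  fixes \<alpha> :: "'i::wellorder" and \<AA> :: "('i, 'a) subst_alg"
  assumes substitution_algebra: "substitution_algebra \<alpha> \<AA>"
    and zero_dim_nonempty: "zero_dim \<alpha> \<AA> \<noteq> {}"
begin

abbreviation "A \<equiv> univ \<AA>"
abbreviation "sb \<equiv> subst \<AA>"
abbreviation "v \<equiv> var \<AA>"
abbreviation "Z \<equiv> zero_dim \<alpha> \<AA>"
abbreviation "\<Delta> \<equiv> dim_set \<alpha> \<AA>"

lemma subst_closed: "\<kappa> < \<alpha> \<Longrightarrow> x \<in> A \<Longrightarrow> y \<in> A \<Longrightarrow> sb \<kappa> x y \<in> A"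
  and var_closed: "\<kappa> < \<alpha> \<Longrightarrow> v \<kappa> \<in> A"
  and subst_var: "\<kappa> < \<alpha> \<Longrightarrow> x \<in> A \<Longrightarrow> sb \<kappa> x (v \<kappa>) = x"
  and subst_other_var: "\<kappa> < \<alpha> \<Longrightarrow> \<mu> < \<alpha> \<Longrightarrow> x \<in> A \<Longrightarrow> \<kappa> \<noteq> \<mu> \<Longrightarrow> sb \<kappa> x (v \<mu>) = v \<mu>"
  and subst_assoc:
    "\<kappa> < \<alpha> \<Longrightarrow> x \<in> A \<Longrightarrow> y \<in> A \<Longrightarrow> z \<in> A \<Longrightarrow> sb \<kappa> (sb \<kappa> x y) z = sb \<kappa> x (sb \<kappa> y z)"
  using substitution_algebraD[OF substitution_algebra] by simp_all

lemma subst_indep: "\<kappa> < \<alpha> \<Longrightarrow> \<kappa> \<notin> \<Delta> x \<Longrightarrow> w \<in> A \<Longrightarrow> sb \<kappa> w x = x"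
  by (auto simp: dim_set_def)

lemma subst_distrib:
  assumes "\<kappa> < \<alpha>" "\<mu> < \<alpha>" "\<kappa> \<noteq> \<mu>" "x \<in> A" "y \<in> A" "z \<in> A" "\<mu> \<notin> \<Delta> x"
  shows "sb \<kappa> x (sb \<mu> y z) = sb \<mu> (sb \<kappa> x y) (sb \<kappa> x z)"
proof -
  have "\<forall>w\<in>A. sb \<mu> w x = x" using assms subst_indep by blast
  then show ?thesis
    using substitution_algebraD(6)[OF substitution_algebra] assms by simp
qed

lemma subst_commute:
  assumes "\<kappa> < \<alpha>" "\<mu> < \<alpha>" "\<kappa> \<noteq> \<mu>" "x \<in> A" "y \<in> A" "z \<in> A" "\<mu> \<notin> \<Delta> x" "\<kappa> \<notin> \<Delta> y"
  shows "sb \<kappa> x (sb \<mu> y z) = sb \<mu> y (sb \<kappa> x z)"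
  using subst_distrib[OF assms(1-7)] subst_indep[of \<kappa> y x] assms by simp

lemma dim_subst_self:
  assumes "\<kappa> < \<alpha>" "x \<in> A" "y \<in> A" "\<kappa> \<notin> \<Delta> x"
  shows "\<kappa> \<notin> \<Delta> (sb \<kappa> x y)"
proof -
  have "sb \<kappa> w (sb \<kappa> x y) = sb \<kappa> x y" if "w \<in> A" for w
    using subst_assoc[of \<kappa> w x y] subst_indep[of \<kappa> x w] assms that by simp
  then show ?thesis by (simp add: dim_set_def)
qed

text \<open>An arbitrary \<open>w\<close> may depend on \<open>\<kappa>\<close>, so its substitution
  need not commute with the one at \<open>\<kappa>\<close>. That of a zero-dimensional
  \<open>u\<close> does, hence substituting \<open>u\<close> at \<open>\<mu>\<close> fixes
  \<open>?q\<close>; associativity extends this to all \<open>w\<close>.\<close>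

lemma dim_subst_other:
  assumes "\<kappa> < \<alpha>" "x \<in> A" "y \<in> A" "\<mu> \<notin> \<Delta> x" "\<mu> \<notin> \<Delta> y" "\<kappa> \<noteq> \<mu>"
  shows "\<mu> \<notin> \<Delta> (sb \<kappa> x y)"
proof (cases "\<mu> < \<alpha>")
  case True
  obtain u where u: "u \<in> A" "\<Delta> u = {}"
    using zero_dim_nonempty by (auto simp: zero_dim_def)
  let ?q = "sb \<kappa> x y"
  have q: "?q \<in> A" using assms subst_closed by blast
  have "sb \<mu> u ?q = sb \<kappa> x (sb \<mu> u y)"
    using subst_commute[of \<kappa> \<mu> x u y] assms True u by simp
  then have uq: "sb \<mu> u ?q = ?q"
    using subst_indep[of \<mu> y u] True assms u by simp
  have "sb \<mu> w ?q = ?q" if "w \<in> A" for w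
    using subst_assoc[of \<mu> w u ?q] subst_indep[of \<mu> u w] uq u q that True by simp
  then show ?thesis by (simp add: dim_set_def)
qed (simp add: dim_set_def)

section \<open>Iterated substitution along lists\<close>

text \<open>The fold of \<open>subst_seq\<close>, but over an arbitrary list, so that indices can be
  split off and reordered. The head of the list is the innermost substitution.\<close>

definition substs :: "('i \<Rightarrow> 'a) \<Rightarrow> 'i list \<Rightarrow> 'a \<Rightarrow> 'a" where
  "substs t = fold (\<lambda>\<kappa>. sb \<kappa> (t \<kappa>))"

lemma substs_simps [simp]:
  "substs t [] a = a"
  "substs t (\<kappa> # xs) a = substs t xs (sb \<kappa> (t \<kappa>) a)"
  "substs t (xs @ ys) a = substs t ys (substs t xs a)"
  by (simp_all add: substs_def)

lemma substs_cong: "(\<And>\<kappa>. \<kappa> \<in> set xs \<Longrightarrow> t \<kappa> = t' \<kappa>) \<Longrightarrow> substs t xs a = substs t' xs a"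
  by (induction xs arbitrary: a) auto

lemma substs_closed:
  "set xs \<subseteq> {..<\<alpha>} \<Longrightarrow> t ` set xs \<subseteq> A \<Longrightarrow> a \<in> A \<Longrightarrow> substs t xs a \<in> A"
  by (induction xs arbitrary: a) (auto simp: subst_closed)

lemma substs_indep:
  assumes "set xs \<subseteq> {..<\<alpha>}" "t ` set xs \<subseteq> A" "a \<in> A" "set xs \<inter> \<Delta> a = {}"
  shows "substs t xs a = a"
  using assms by (induction xs) (auto simp: subst_indep)

lemma subst_substs_commute:
  assumes "set xs \<subseteq> {..<\<alpha>}" "t ` set xs \<subseteq> A" "a \<in> A" "\<kappa> < \<alpha>" "\<kappa> \<notin> set xs" "c \<in> A"
    and "\<Delta> c \<inter> set xs = {}" "\<And>\<mu>. \<mu> \<in> set xs \<Longrightarrow> \<kappa> \<notin> \<Delta> (t \<mu>)"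
  shows "substs t xs (sb \<kappa> c a) = sb \<kappa> c (substs t xs a)"
  using assms
proof (induction xs arbitrary: a)
  case (Cons \<mu> xs)
  have "sb \<mu> (t \<mu>) (sb \<kappa> c a) = sb \<kappa> c (sb \<mu> (t \<mu>) a)"
    by (rule subst_commute) (use Cons.prems in auto)
  moreover have "substs t xs (sb \<kappa> c (sb \<mu> (t \<mu>) a)) = sb \<kappa> c (substs t xs (sb \<mu> (t \<mu>) a))"
    by (rule Cons.IH) (use Cons.prems subst_closed in auto)
  ultimately show ?case by simp
qed simp

text \<open>Each step is \<open>subst_distrib\<close>, which asks nothing of the dimension sets of
  \<open>a\<close> and \<open>b\<close>; so the induction can continue with their substituted
  versions.\<close>

lemma substs_distrib:
  assumes "set xs \<subseteq> {..<\<alpha>}" "t ` set xs \<subseteq> A" "a \<in> A" "b \<in> A" "\<kappa> < \<alpha>" "\<kappa> \<notin> set xs"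
    and "\<And>\<mu>. \<mu> \<in> set xs \<Longrightarrow> \<kappa> \<notin> \<Delta> (t \<mu>)"
  shows "substs t xs (sb \<kappa> a b) = sb \<kappa> (substs t xs a) (substs t xs b)"
  using assms
proof (induction xs arbitrary: a b)
  case (Cons \<mu> xs)
  have "sb \<mu> (t \<mu>) (sb \<kappa> a b) = sb \<kappa> (sb \<mu> (t \<mu>) a) (sb \<mu> (t \<mu>) b)"
    by (rule subst_distrib) (use Cons.prems in auto)
  moreover have "substs t xs (sb \<kappa> (sb \<mu> (t \<mu>) a) (sb \<mu> (t \<mu>) b)) =
      sb \<kappa> (substs t xs (sb \<mu> (t \<mu>) a)) (substs t xs (sb \<mu> (t \<mu>) b))"
    by (rule Cons.IH) (use Cons.prems subst_closed in auto)
  ultimately show ?case by simp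
qed simp

text \<open>Substituting at an index removes it from the dimension set, and later substitutions do
  not bring it back, as their values avoid all indices of \<open>xs\<close>.\<close>

lemma dim_substs:
  assumes "set xs \<subseteq> {..<\<alpha>}" "t ` set xs \<subseteq> A" "a \<in> A"
    and "\<And>\<mu>. \<mu> \<in> set xs \<Longrightarrow> \<Delta> (t \<mu>) \<inter> set xs = {}"
  shows "\<Delta> (substs t xs a) \<inter> set xs = {}"
proof -
  \<comment> \<open>The hypothesis on \<open>t\<close> keeps referring to all of \<open>xs\<close>
    while \<open>ys\<close> grows. Growth is on the right because the last substitution is the
    outermost.\<close>
  have "\<Delta> (substs t ys a) \<inter> set ys = {}" if "set ys \<subseteq> set xs" for ys
    using that
  proof (induction ys rule: rev_induct)
    case (snoc \<kappa> ys)
    have A: "substs t ys a \<in> A"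
      by (rule substs_closed) (use snoc.prems assms in \<open>auto simp: image_subset_iff\<close>)
    have "\<mu> \<notin> \<Delta> (sb \<kappa> (t \<kappa>) (substs t ys a))" if "\<mu> \<in> set (ys @ [\<kappa>])" for \<mu>
    proof (cases "\<mu> = \<kappa>")
      case True
      have "\<kappa> \<notin> \<Delta> (sb \<kappa> (t \<kappa>) (substs t ys a))"
        by (rule dim_subst_self) (use snoc.prems assms A in auto)
      then show ?thesis using True by simp
    next
      case False
      have "\<Delta> (t \<kappa>) \<inter> set xs = {}" using snoc.prems assms(4) by simp
      show ?thesis
        by (rule dim_subst_other) (use \<open>\<Delta> (t \<kappa>) \<inter> set xs = {}\<close> False that snoc assms(1-3) A in auto)
    qed
    then show ?case by auto
  qed simp
  then show ?thesis by blast
qed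

text \<open>Only the substitutions in \<open>ys\<close> have to be passed, and they commute with the
  one at \<open>\<kappa>\<close> because no value depends on an index of the list.\<close>

lemma substs_move_front:
  assumes "set (ys @ \<kappa> # zs) \<subseteq> {..<\<alpha>}" "distinct (ys @ \<kappa> # zs)"
    and "t ` set (ys @ \<kappa> # zs) \<subseteq> A" "a \<in> A"
    and "\<And>\<mu>. \<mu> \<in> set (ys @ \<kappa> # zs) \<Longrightarrow> \<Delta> (t \<mu>) \<inter> set (ys @ \<kappa> # zs) = {}"
  shows "substs t (ys @ \<kappa> # zs) a = substs t (ys @ zs) (sb \<kappa> (t \<kappa>) a)"
proof -
  have "substs t ys (sb \<kappa> (t \<kappa>) a) = sb \<kappa> (t \<kappa>) (substs t ys a)"
    by (rule subst_substs_commute) (use assms in auto)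
  then show ?thesis by simp
qed

text \<open>This is the homomorphism condition at one finite index set. With \<open>\<kappa>\<close>
  innermost, associativity absorbs \<open>t \<kappa>\<close> into \<open>a\<close>, and the
  remaining substitutions distribute over both arguments; the first argument becomes the new entry
  at \<open>\<kappa>\<close>.\<close>

lemma substs_subst:
  assumes "set xs \<subseteq> {..<\<alpha>}" "distinct xs" "t ` set xs \<subseteq> A" "a \<in> A" "b \<in> A" "\<kappa> \<in> set xs"
    and "\<And>\<mu>. \<mu> \<in> set xs \<Longrightarrow> \<Delta> (t \<mu>) \<inter> set xs = {}"
  shows "substs t xs (sb \<kappa> a b) = substs (t(\<kappa> := substs t xs a)) xs b"
proof -
  obtain ys zs where xs: "xs = ys @ \<kappa> # zs"
    using assms(6) by (meson split_list)
  define ws where "ws = ys @ zs"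
  have ws: "set ws \<subseteq> {..<\<alpha>}" "t ` set ws \<subseteq> A" "\<kappa> \<notin> set ws" "\<kappa> < \<alpha>" "t \<kappa> \<in> A"
      "set ws \<subseteq> set xs" "\<And>\<mu>. \<mu> \<in> set ws \<Longrightarrow> \<kappa> \<notin> \<Delta> (t \<mu>)"
    using assms by (auto simp: ws_def xs)
  define c where "c = substs t xs a"
  have c: "c \<in> A" "\<Delta> c \<inter> set xs = {}"
    unfolding c_def using assms by (simp_all add: substs_closed dim_substs)
  have move: "substs t xs d = substs t ws (sb \<kappa> (t \<kappa>) d)" if "d \<in> A" for d
    unfolding xs ws_def by (rule substs_move_front) (use assms xs that in auto)
  have "substs t xs (sb \<kappa> a b) = substs t ws (sb \<kappa> (sb \<kappa> (t \<kappa>) a) b)"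
    using move[of "sb \<kappa> a b"] subst_assoc[of \<kappa> "t \<kappa>" a b] subst_closed assms ws by simp
  also have "\<dots> = sb \<kappa> (substs t ws (sb \<kappa> (t \<kappa>) a)) (substs t ws b)"
    by (rule substs_distrib) (use ws assms subst_closed in auto)
  also have "\<dots> = sb \<kappa> c (substs t ws b)"
    using move[of a] assms by (simp add: c_def)
  \<comment> \<open>Since \<open>c\<close> depends on no index of \<open>xs\<close>, its
    substitution can return to the innermost position.\<close>
  also have "\<dots> = substs t ws (sb \<kappa> c b)"
    by (rule subst_substs_commute[symmetric]) (use ws assms c in auto)
  also have "\<dots> = substs (t(\<kappa> := c)) ws (sb \<kappa> c b)"
    by (rule substs_cong) (use ws in auto)
  also have "\<dots> = substs (t(\<kappa> := c)) xs b"
    unfolding xs ws_def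
    by (subst substs_move_front) (use assms c in \<open>auto simp: xs\<close>)
  finally show ?thesis by (simp add: c_def)
qed

text \<open>Once \<open>\<kappa>\<close> is innermost, \<open>v \<kappa>\<close> turns into
  \<open>t \<kappa>\<close>, which the other substitutions leave unchanged.\<close>

lemma substs_var:
  assumes "set xs \<subseteq> {..<\<alpha>}" "distinct xs" "t ` set xs \<subseteq> A" "\<kappa> \<in> set xs"
    and "\<And>\<mu>. \<mu> \<in> set xs \<Longrightarrow> \<Delta> (t \<mu>) \<inter> set xs = {}"
  shows "substs t xs (v \<kappa>) = t \<kappa>"
proof -
  obtain ys zs where xs: "xs = ys @ \<kappa> # zs"
    using assms(4) by (meson split_list)
  have "substs t xs (v \<kappa>) = substs t (ys @ zs) (t \<kappa>)"
    unfolding xs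
    by (subst substs_move_front) (use assms xs var_closed subst_var in auto)
  also have "\<dots> = t \<kappa>"
    by (rule substs_indep) (use assms xs in auto)
  finally show ?thesis .
qed

section \<open>Nets and their representatives up to eventual equality\<close>

abbreviation "\<F> \<equiv> finite_subsets_at_top {..<\<alpha>}"

text \<open>Only values at finite subsets of \<open>{..<\<alpha>}\<close> are constrained; these are
  the only ones that the filter \<open>\<F>\<close> sees.\<close>

definition nets :: "('i set \<Rightarrow> 'a) set" where
  "nets = {f. \<forall>\<Sigma>. finite \<Sigma> \<longrightarrow> \<Sigma> \<subseteq> {..<\<alpha>} \<longrightarrow> f \<Sigma> \<in> A \<and> \<Delta> (f \<Sigma>) \<inter> \<Sigma> = {}}"

text \<open>The case distinction makes constant nets with zero-dimensional value their own representatives.\<close>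

definition rep :: "('i set \<Rightarrow> 'a) \<Rightarrow> 'i set \<Rightarrow> 'a" where
  "rep f =
    (if \<exists>z\<in>Z. \<forall>\<^sub>F \<Sigma> in \<F>. f \<Sigma> = z then (\<lambda>_. SOME z. z \<in> Z \<and> (\<forall>\<^sub>F \<Sigma> in \<F>. f \<Sigma> = z))
     else (SOME g. g \<in> nets \<and> (\<forall>\<^sub>F \<Sigma> in \<F>. f \<Sigma> = g \<Sigma>)))"

lemma const_in_nets: "z \<in> Z \<Longrightarrow> (\<lambda>_. z) \<in> nets"
  by (auto simp: nets_def zero_dim_def)

lemma rep:
  assumes "f \<in> nets"
  shows rep_in_nets: "rep f \<in> nets" and rep_eventually_eq: "\<forall>\<^sub>F \<Sigma> in \<F>. f \<Sigma> = rep f \<Sigma>"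
proof -
  have "rep f \<in> nets \<and> (\<forall>\<^sub>F \<Sigma> in \<F>. f \<Sigma> = rep f \<Sigma>)"
  proof (cases "\<exists>z\<in>Z. \<forall>\<^sub>F \<Sigma> in \<F>. f \<Sigma> = z")
    case True
    then have "\<exists>z. z \<in> Z \<and> (\<forall>\<^sub>F \<Sigma> in \<F>. f \<Sigma> = z)" by blast
    from someI_ex[OF this] show ?thesis
      using True const_in_nets by (simp add: rep_def)
  next
    case False
    have "\<exists>g. g \<in> nets \<and> (\<forall>\<^sub>F \<Sigma> in \<F>. f \<Sigma> = g \<Sigma>)"
      using assms by (intro exI[of _ f]) simp
    from someI_ex[OF this] show ?thesis
      using False by (simp add: rep_def)
  qed
  then show "rep f \<in> nets" "\<forall>\<^sub>F \<Sigma> in \<F>. f \<Sigma> = rep f \<Sigma>" by auto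
qed

text \<open>The definition of \<open>rep f\<close> refers to \<open>f\<close> only through the
  functions it is eventually equal to.\<close>

lemma rep_cong:
  assumes "\<forall>\<^sub>F \<Sigma> in \<F>. f \<Sigma> = g \<Sigma>"
  shows "rep f = rep g"
proof -
  have "(\<forall>\<^sub>F \<Sigma> in \<F>. f \<Sigma> = h \<Sigma>) \<longleftrightarrow> (\<forall>\<^sub>F \<Sigma> in \<F>. g \<Sigma> = h \<Sigma>)" for h
    by (rule eventually_cong[OF assms]) simp
  then show ?thesis unfolding rep_def by presburger
qed

lemma rep_idem: "f \<in> nets \<Longrightarrow> rep (rep f) = rep f"
  using rep_cong[OF rep_eventually_eq] by metis

lemma rep_const:
  assumes "z \<in> Z"
  shows "rep (\<lambda>_. z) = (\<lambda>_. z)"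
proof -
  \<comment> \<open>The filter is proper, so distinct constants are never eventually equal and the
    choice in \<open>rep\<close> is forced.\<close>
  have "(\<forall>\<^sub>F \<Sigma> in \<F>. z = y) \<longleftrightarrow> z = y" for y
    by (simp add: eventually_const)
  then show ?thesis
    using assms by (auto simp: rep_def intro!: some_equality)
qed

definition base :: "('i set \<Rightarrow> 'a) set" where
  "base = rep ` nets"

lemma base_subset_nets: "base \<subseteq> nets"
  by (auto simp: base_def rep_in_nets)

lemma rep_base: "f \<in> base \<Longrightarrow> rep f = f"
  by (auto simp: base_def rep_idem)

lemma const_in_base: "z \<in> Z \<Longrightarrow> (\<lambda>_. z) \<in> base"
  using rep_const const_in_nets by (metis base_def imageI)

section \<open>The representation by functions on the base\<close>

definition net_subst :: "('i \<Rightarrow> 'i set \<Rightarrow> 'a) \<Rightarrow> 'a \<Rightarrow> 'i set \<Rightarrow> 'a" where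
  "net_subst s a \<Sigma> = subst_seq \<AA> (\<lambda>\<kappa>. s \<kappa> \<Sigma>) \<Sigma> a"

lemma net_subst_eq: "net_subst s a \<Sigma> = substs (\<lambda>\<kappa>. s \<kappa> \<Sigma>) (sorted_list_of_set \<Sigma>) a"
  by (simp add: net_subst_def subst_seq_def substs_def)

text \<open>Evaluated at a finite \<open>\<Sigma>\<close>, a tuple of base nets satisfies the
  hypotheses that the list lemmas put on \<open>t\<close>.\<close>

lemma tuples_base:
  assumes "s \<in> tuples \<alpha> base" "finite \<Sigma>" "\<Sigma> \<subseteq> {..<\<alpha>}" "\<kappa> \<in> \<Sigma>"
  shows "s \<kappa> \<Sigma> \<in> A" "\<Delta> (s \<kappa> \<Sigma>) \<inter> \<Sigma> = {}"
proof -
  have "s \<kappa> \<in> nets" using assms base_subset_nets by (auto simp: tuples_def)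
  then show "s \<kappa> \<Sigma> \<in> A" "\<Delta> (s \<kappa> \<Sigma>) \<inter> \<Sigma> = {}" using assms by (auto simp: nets_def)
qed

lemma net_subst_in_nets:
  assumes "s \<in> tuples \<alpha> base" "a \<in> A"
  shows "net_subst s a \<in> nets"
proof -
  have "net_subst s a \<Sigma> \<in> A \<and> \<Delta> (net_subst s a \<Sigma>) \<inter> \<Sigma> = {}"
    if S: "finite \<Sigma>" "\<Sigma> \<subseteq> {..<\<alpha>}" for \<Sigma>
  proof
    show "net_subst s a \<Sigma> \<in> A"
      unfolding net_subst_eq
      by (rule substs_closed) (use assms S tuples_base in auto)
    have "\<Delta> (net_subst s a \<Sigma>) \<inter> set (sorted_list_of_set \<Sigma>) = {}"
      unfolding net_subst_eq
      by (rule dim_substs) (use assms S tuples_base in auto)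
    then show "\<Delta> (net_subst s a \<Sigma>) \<inter> \<Sigma> = {}" using S by simp
  qed
  then show ?thesis by (simp add: nets_def)
qed

lemma eventually_containing:
  assumes "\<kappa> < \<alpha>"
  shows "\<forall>\<^sub>F \<Sigma> in \<F>. finite \<Sigma> \<and> \<Sigma> \<subseteq> {..<\<alpha>} \<and> \<kappa> \<in> \<Sigma>"
  unfolding eventually_finite_subsets_at_top using assms by (intro exI[of _ "{\<kappa>}"]) auto

definition repr :: "'a \<Rightarrow> ('i \<Rightarrow> 'i set \<Rightarrow> 'a) \<Rightarrow> 'i set \<Rightarrow> 'a" where
  "repr a = (\<lambda>s\<in>tuples \<alpha> base. rep (net_subst s a))"

lemma repr_in_base: "s \<in> tuples \<alpha> base \<Longrightarrow> a \<in> A \<Longrightarrow> repr a s \<in> base"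
  by (simp add: repr_def base_def net_subst_in_nets)

text \<open>The two nets agree at every \<open>\<Sigma>\<close> containing \<open>\<kappa>\<close>,
  and \<open>s \<kappa>\<close> is its own representative.\<close>

lemma repr_var:
  assumes "\<kappa> < \<alpha>"
  shows "repr (v \<kappa>) = fun_var \<alpha> base \<kappa>"
proof -
  have "rep (net_subst s (v \<kappa>)) = s \<kappa>" if s: "s \<in> tuples \<alpha> base" for s
  proof -
    have "\<forall>\<^sub>F \<Sigma> in \<F>. net_subst s (v \<kappa>) \<Sigma> = s \<kappa> \<Sigma>"
      using eventually_containing[OF assms]
    proof eventually_elim
      case (elim \<Sigma>)
      show ?case unfolding net_subst_eq
        by (rule substs_var) (use elim s tuples_base in auto)
    qed
    then have "rep (net_subst s (v \<kappa>)) = rep (s \<kappa>)" by (rule rep_cong)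
    also have "\<dots> = s \<kappa>" using s assms by (intro rep_base) (auto simp: tuples_def)
    finally show ?thesis .
  qed
  then show ?thesis by (auto simp: repr_def fun_var_def restrict_def)
qed

text \<open>Two conditions on \<open>\<Sigma>\<close> are combined: it contains
  \<open>\<kappa>\<close>, and \<open>net_subst s a\<close> agrees there with its representative.
  Both hold eventually, so \<open>rep\<close> identifies the two sides.\<close>

lemma repr_subst:
  assumes "\<kappa> < \<alpha>" "a \<in> A" "b \<in> A"
  shows "repr (sb \<kappa> a b) = fun_subst \<alpha> base \<kappa> (repr a) (repr b)"
proof -
  have "rep (net_subst s (sb \<kappa> a b)) = repr b (s(\<kappa> := repr a s))"
    if s: "s \<in> tuples \<alpha> base" for s
  proof -
    have s': "s(\<kappa> := repr a s) \<in> tuples \<alpha> base"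
      using s repr_in_base[OF s assms(2)] assms(1) by (auto simp: tuples_def PiE_iff extensional_def)
    have "\<forall>\<^sub>F \<Sigma> in \<F>. net_subst s a \<Sigma> = repr a s \<Sigma>"
      using rep_eventually_eq[OF net_subst_in_nets[OF s assms(2)]] s by (simp add: repr_def)
    then have "\<forall>\<^sub>F \<Sigma> in \<F>. net_subst s (sb \<kappa> a b) \<Sigma> = net_subst (s(\<kappa> := repr a s)) b \<Sigma>"
      using eventually_containing[OF assms(1)]
    proof eventually_elim
      case (elim \<Sigma>)
      have "net_subst s (sb \<kappa> a b) \<Sigma> =
          substs ((\<lambda>\<mu>. s \<mu> \<Sigma>)(\<kappa> := net_subst s a \<Sigma>)) (sorted_list_of_set \<Sigma>) b"
        unfolding net_subst_eq
        by (rule substs_subst) (use elim s assms tuples_base in auto)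
      \<comment> \<open>Only the entry at \<open>\<kappa>\<close> is replaced by a representative,
        and at this \<open>\<Sigma>\<close> the replacement changes nothing.\<close>
      also have "(\<lambda>\<mu>. s \<mu> \<Sigma>)(\<kappa> := net_subst s a \<Sigma>) = (\<lambda>\<mu>. (s(\<kappa> := repr a s)) \<mu> \<Sigma>)"
        using elim by auto
      finally show ?case by (simp only: net_subst_eq)
    qed
    from rep_cong[OF this] show ?thesis using s' by (simp add: repr_def)
  qed
  then show ?thesis by (auto simp: repr_def fun_subst_def restrict_def)
qed

lemma repr_inj:
  assumes "strongly_distinguished \<alpha> \<AA>"
  shows "inj_on repr A"
proof (rule inj_onI)
  fix a b assume ab: "a \<in> A" "b \<in> A" and eq: "repr a = repr b"
  have "\<exists>\<Sigma>. finite \<Sigma> \<and> \<Sigma> \<subseteq> {..<\<alpha>} \<and> subst_seq \<AA> s \<Sigma> a = subst_seq \<AA> s \<Sigma> b"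
    if s: "s \<in> tuples \<alpha> Z" for s
  proof -
    \<comment> \<open>Tuples over \<open>Z\<close> become tuples of constant nets, which lie in the
      base.\<close>
    define s' where "s' = (\<lambda>\<kappa>\<in>{..<\<alpha>}. \<lambda>_::'i set. s \<kappa>)"
    have s': "s' \<in> tuples \<alpha> base"
      using s by (simp add: s'_def tuples_def PiE_iff const_in_base)
    have reps: "rep (net_subst s' a) = rep (net_subst s' b)"
      using fun_cong[OF eq, of s'] s' by (simp add: repr_def)
    have "\<forall>\<^sub>F \<Sigma> in \<F>. net_subst s' a \<Sigma> = net_subst s' b \<Sigma>"
      using rep_eventually_eq[OF net_subst_in_nets[OF s' ab(1)]]
        rep_eventually_eq[OF net_subst_in_nets[OF s' ab(2)]]
      by eventually_elim (simp add: reps)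
    \<comment> \<open>The finite set from which on the equality holds is itself a valid
      \<open>\<Sigma>\<close>.\<close>
    then obtain \<Sigma> where S: "finite \<Sigma>" "\<Sigma> \<subseteq> {..<\<alpha>}" "net_subst s' a \<Sigma> = net_subst s' b \<Sigma>"
      unfolding eventually_finite_subsets_at_top by blast
    have "net_subst s' c \<Sigma> = subst_seq \<AA> s \<Sigma> c" for c
      unfolding net_subst_eq subst_seq_def substs_def[symmetric]
      by (rule substs_cong) (use S in \<open>auto simp: s'_def\<close>)
    then show ?thesis using S by auto
  qed
  then show "a = b" using assms ab unfolding strongly_distinguished_def by blast
qed

theorem strongly_distinguished_imp_representable:
  assumes "strongly_distinguished \<alpha> \<AA>"
  shows "representable TYPE('i set \<Rightarrow> 'a) \<alpha> \<AA>"
proof -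
  \<comment> \<open>The image of \<open>A\<close> is closed under the function operations because
    \<open>repr_subst\<close> and \<open>repr_var\<close> rewrite them as images of operations in
    \<open>A\<close>.\<close>
  define \<BB> where "\<BB> = \<lparr>univ = repr ` A, subst = fun_subst \<alpha> base, var = fun_var \<alpha> base\<rparr>"
  have "base \<noteq> {}" using zero_dim_nonempty const_in_base by blast
  moreover have "repr ` A \<subseteq> funs \<alpha> base"
    using repr_in_base by (auto simp: funs_def repr_def)
  ultimately have "function_substitution_algebra \<alpha> base \<BB>"
    unfolding function_substitution_algebra_def \<BB>_def
    by (auto simp flip: repr_subst repr_var simp: subst_closed var_closed)
  moreover have "subst_alg_iso \<alpha> \<AA> \<BB> repr"
    unfolding subst_alg_iso_def \<BB>_def
    by (simp add: repr_subst repr_var repr_inj[OF assms] bij_betw_def)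
  ultimately show ?thesis unfolding representable_def by blast
qed

end

section \<open>The empty algebra and the existence of zero-dimensional elements\<close>

text \<open>Every index below \<open>\<alpha>\<close> would give a variable in the empty universe,
  so \<open>\<alpha>\<close> is zero and the empty set of functions is a function substitution
  algebra.\<close>

lemma representable_empty:
  assumes "substitution_algebra \<alpha> \<AA>" "univ \<AA> = {}"
  shows "representable TYPE('u) \<alpha> \<AA>"
proof -
  have "\<not> \<kappa> < \<alpha>" for \<kappa>
    using substitution_algebraD(2)[OF assms(1)] assms(2) by simp
  then have "function_substitution_algebra \<alpha> (UNIV :: 'u set) \<lparr>univ = {}, subst = undefined, var = undefined\<rparr>"
    and "subst_alg_iso \<alpha> \<AA> \<lparr>univ = {}, subst = undefined, var = undefined\<rparr> h"
    for h :: "_ \<Rightarrow> (_ \<Rightarrow> 'u) \<Rightarrow> 'u"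
    using assms(2) by (simp_all add: function_substitution_algebra_def subst_alg_iso_def bij_betw_def)
  then show ?thesis unfolding representable_def by blast
qed

text \<open>If \<open>Z\<close> were empty, a nonempty universe would force an index below
  \<open>\<alpha>\<close>. Then no tuples over \<open>Z\<close> exist, so strong distinguishedness
  vacuously identifies all elements, although substitution moves \<open>a\<close>.\<close>

lemma strongly_distinguished_zero_dim_nonempty:
  assumes alg: "substitution_algebra \<alpha> \<AA>" and sd: "strongly_distinguished \<alpha> \<AA>" and ne: "univ \<AA> \<noteq> {}"
  shows "zero_dim \<alpha> \<AA> \<noteq> {}"
proof
  assume empty: "zero_dim \<alpha> \<AA> = {}"
  obtain a where a: "a \<in> univ \<AA>" using ne by blast
  then have "dim_set \<alpha> \<AA> a \<noteq> {}" using empty by (auto simp: zero_dim_def)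
  then obtain \<kappa> b where k: "\<kappa> < \<alpha>" "b \<in> univ \<AA>" "subst \<AA> \<kappa> b a \<noteq> a"
    by (auto simp: dim_set_def)
  have "subst \<AA> \<kappa> b a \<in> univ \<AA>"
    using substitution_algebraD(1)[OF alg] a k by simp
  moreover have "tuples \<alpha> (zero_dim \<alpha> \<AA>) = {}"
    using k(1) empty by (auto simp: tuples_def PiE_eq_empty_iff)
  ultimately show False
    using sd a k(3) unfolding strongly_distinguished_def by blast
qed

theorem theorem3p2:
  fixes \<alpha> :: "'i::wellorder" and \<AA> :: "('i, 'a) subst_alg"
  assumes "substitution_algebra \<alpha> \<AA>"
    and "strongly_distinguished \<alpha> \<AA>"
  shows "representable TYPE('i set \<Rightarrow> 'a) \<alpha> \<AA>"
proof (cases "univ \<AA> = {}")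
  case True
  then show ?thesis using assms(1) by (rule representable_empty[rotated])
next
  case False
  \<comment> \<open>Nonemptiness of the universe yields the zero-dimensional element that the locale
    requires.\<close>
  interpret substitution_algebra_with_zero \<alpha> \<AA>
    using assms False strongly_distinguished_zero_dim_nonempty by unfold_locales
  show ?thesis using assms(2) by (rule strongly_distinguished_imp_representable)
qed

end
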